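(* Suppose the standing assumptions on $p,P,\phi_{tsa},\psi_{ts}$ listed in the context hold. Suppose $(y,z)$ is an optimal solution of the optimization problem (P) of the context and $(u,v,w,\lambda)$ is an optimal solution of the optimization problem (D) of the context. Then the following hold. (i) For every $t\in[T]$, $s\in[S]$ with $p_{ts}>0$: - if $z_{ts}=0$, then $v_{ts}\le \psi_{ts}(p_{ts})$; - if $0<z_{ts}<p_{ts}$, then $v_{ts}=\psi_{ts}(z_{ts})$; - if $z_{ts}=p_{ts}$, then $v_{ts}\ge \psi_{ts}(0)$. (ii) For every $s\in[S]$, $a\in[A]$: if $y_{Tsa}>0$, then $$v_{Ts}=\min_{a'\in[A]}\phi_{Tsa'}(y_{Tsa'})\quad\text{and } a \text{ attains this minimum};$$ and for every $t\in[T-1]$, if $y_{tsa}>0$, then $$v_{ts}=\min_{a'\in[A]}\Big(\phi_{tsa'}(y_{tsa'})+\sum_{s'\in[S]}P_{sa's'}v_{t+1,s'}\Big)\quad\text{and } a\text{ attains this minimum}.$$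
   Context: For a positive integer $N$, $[N]=\{1,\dots,N\}$. $T,S,A$ are positive integers (numbers of time steps, states, actions). Unless indicated otherwise, $\sum_{t,s,a}$ ranges over $t\in[T],s\in[S],a\in[A]$, $\sum_{t,s}$ over $t\in[T],s\in[S]$, and so on. Standing assumptions: $p\in\mathbb{R}_+^{T\times S}$ (nonnegative entries); $P\in[0,1]^{S\times A\times S}$ with $\sum_{s'}P_{sas'}=1$ for all $s\in[S],a\in[A]$ ($P_{sas'}$ is the probability of moving from $s$ to $s'$ under action $a$). Let $\rho=\sum_{t,s}p_{ts}$. For all $t,s,a$, the functions $\phi_{tsa}:[0,\rho]\to\mathbb{R}$ and $\psi_{ts}:[0,\rho]\to\mathbb{R}$ are continuous and strictly increasing. Problem (P): over $y\in\mathbb{R}^{T\times S\times A}$, $z\in\mathbb{R}^{T\times S}$, minimize $$\sum_{t,s,a}\int_0^{y_{tsa}}\phi_{tsa}(\alpha)\,d\alpha+\sum_{t,s}\int_0^{z_{ts}}\psi_{ts}(\alpha)\,d\alpha$$ subject to, for all $s\in[S]$: $\sum_a y_{1sa}=p_{1s}-z_{1s}$; $\sum_a y_{t+1,sa}=p_{t+1,s}-z_{t+1,s}+\sum_{s',a}P_{s'as}y_{ts'a}$ for $t\in[T-1]$; and $y_{tsa}\ge 0$, $0\le z_{ts}\le p_{ts}$ for all $t\in[T],s\in[S],a\in[A]$. Problem (D): over $u\in\mathbb{R}^{T\times S\times A}$ and $v,w,\lambda\in\mathbb{R}^{T\times S}$, maximize $$\sum_{t,s}p_{ts}(v_{ts}-\lambda_{ts})-\sum_{t,s,a}\int_{\phi_{tsa}(0)}^{u_{tsa}}\phi_{tsa}^{-1}(\alpha)\,d\alpha-\sum_{t,s}\int_{\psi_{ts}(0)}^{w_{ts}}\psi_{ts}^{-1}(\alpha)\,d\alpha$$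 subject to, for all $s\in[S],a\in[A]$: $v_{Ts}\le u_{Tsa}$; $v_{ts}\le u_{tsa}+\sum_{s'}P_{sas'}v_{t+1,s'}$ for $t\in[T-1]$; $v_{ts}\le w_{ts}+\lambda_{ts}$ and $\lambda_{ts}\ge 0$ for all $t\in[T]$. Here $u_{tsa}$ and $w_{ts}$ range over the domains of the inverse functions, i.e. $u_{tsa}\in[\phi_{tsa}(0),\phi_{tsa}(\rho)]$ and $w_{ts}\in[\psi_{ts}(0),\psi_{ts}(\rho)]$. *)

theory Defs
  imports "HOL-Analysis.Analysis"
begin

text \<open>
  The index sets are the integer intervals \<open>{1..T}\<close>, \<open>{1..S}\<close>, \<open>{1..A}\<close>. Arrays are functions on
  natural numbers; the definitions below only inspect their entries at indices in these intervals,
  so the values elsewhere play no role. The entry \<open>P s a s'\<close> is the probability of moving from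
  \<open>s\<close> to \<open>s'\<close> under action \<open>a\<close>.
\<close>

definition total_mass :: "nat \<Rightarrow> nat \<Rightarrow> (nat \<Rightarrow> nat \<Rightarrow> real) \<Rightarrow> real" where
  "total_mass T S p = (\<Sum>t\<in>{1..T}. \<Sum>s\<in>{1..S}. p t s)"

definition primal_feasible ::
  "nat \<Rightarrow> nat \<Rightarrow> nat \<Rightarrow> (nat \<Rightarrow> nat \<Rightarrow> real) \<Rightarrow> (nat \<Rightarrow> nat \<Rightarrow> nat \<Rightarrow> real)
    \<Rightarrow> (nat \<Rightarrow> nat \<Rightarrow> nat \<Rightarrow> real) \<Rightarrow> (nat \<Rightarrow> nat \<Rightarrow> real) \<Rightarrow> bool" where
  "primal_feasible T S A p P y z \<longleftrightarrow>
     (\<forall>s\<in>{1..S}. (\<Sum>a\<in>{1..A}. y 1 s a) = p 1 s - z 1 s) \<and>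
     (\<forall>t\<in>{1..<T}. \<forall>s\<in>{1..S}.
        (\<Sum>a\<in>{1..A}. y (t + 1) s a)
          = p (t + 1) s - z (t + 1) s + (\<Sum>s'\<in>{1..S}. \<Sum>a\<in>{1..A}. P s' a s * y t s' a)) \<and>
     (\<forall>t\<in>{1..T}. \<forall>s\<in>{1..S}. \<forall>a\<in>{1..A}. 0 \<le> y t s a) \<and>
     (\<forall>t\<in>{1..T}. \<forall>s\<in>{1..S}. 0 \<le> z t s \<and> z t s \<le> p t s)"

text \<open>
  Every feasible point has \<open>0 \<le> y t s a \<le> total_mass T S p\<close> and \<open>0 \<le> z t s \<le> total_mass T S p\<close>
  (conservation of mass), so on the feasible set the integrals below involve \<open>\<phi>\<close> and \<open>\<psi>\<close> only on
  their domain \<open>{0..total_mass T S p}\<close>.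
\<close>

definition primal_objective ::
  "nat \<Rightarrow> nat \<Rightarrow> nat \<Rightarrow> (nat \<Rightarrow> nat \<Rightarrow> nat \<Rightarrow> real \<Rightarrow> real) \<Rightarrow> (nat \<Rightarrow> nat \<Rightarrow> real \<Rightarrow> real)
    \<Rightarrow> (nat \<Rightarrow> nat \<Rightarrow> nat \<Rightarrow> real) \<Rightarrow> (nat \<Rightarrow> nat \<Rightarrow> real) \<Rightarrow> real" where
  "primal_objective T S A \<phi> \<psi> y z =
     (\<Sum>t\<in>{1..T}. \<Sum>s\<in>{1..S}. \<Sum>a\<in>{1..A}. integral {0..y t s a} (\<phi> t s a)) +
     (\<Sum>t\<in>{1..T}. \<Sum>s\<in>{1..S}. integral {0..z t s} (\<psi> t s))"

definition primal_optimal ::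
  "nat \<Rightarrow> nat \<Rightarrow> nat \<Rightarrow> (nat \<Rightarrow> nat \<Rightarrow> real) \<Rightarrow> (nat \<Rightarrow> nat \<Rightarrow> nat \<Rightarrow> real)
    \<Rightarrow> (nat \<Rightarrow> nat \<Rightarrow> nat \<Rightarrow> real \<Rightarrow> real) \<Rightarrow> (nat \<Rightarrow> nat \<Rightarrow> real \<Rightarrow> real)
    \<Rightarrow> (nat \<Rightarrow> nat \<Rightarrow> nat \<Rightarrow> real) \<Rightarrow> (nat \<Rightarrow> nat \<Rightarrow> real) \<Rightarrow> bool" where
  "primal_optimal T S A p P \<phi> \<psi> y z \<longleftrightarrow>
     is_arg_min (\<lambda>(y, z). primal_objective T S A \<phi> \<psi> y z)
       (\<lambda>(y, z). primal_feasible T S A p P y z) (y, z)"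

text \<open>
  The first two conjuncts of \<open>dual_feasible\<close> say that \<open>u t s a\<close> and \<open>w t s\<close> lie in the domains of
  the inverses of \<open>\<phi> t s a\<close> and \<open>\<psi> t s\<close>, which are regarded as functions on
  \<open>{0..total_mass T S p}\<close>.
\<close>

definition dual_feasible ::
  "nat \<Rightarrow> nat \<Rightarrow> nat \<Rightarrow> (nat \<Rightarrow> nat \<Rightarrow> real) \<Rightarrow> (nat \<Rightarrow> nat \<Rightarrow> nat \<Rightarrow> real)
    \<Rightarrow> (nat \<Rightarrow> nat \<Rightarrow> nat \<Rightarrow> real \<Rightarrow> real) \<Rightarrow> (nat \<Rightarrow> nat \<Rightarrow> real \<Rightarrow> real)
    \<Rightarrow> (nat \<Rightarrow> nat \<Rightarrow> nat \<Rightarrow> real) \<Rightarrow> (nat \<Rightarrow> nat \<Rightarrow> real) \<Rightarrow> (nat \<Rightarrow> nat \<Rightarrow> real)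
    \<Rightarrow> (nat \<Rightarrow> nat \<Rightarrow> real) \<Rightarrow> bool" where
  "dual_feasible T S A p P \<phi> \<psi> u v w l \<longleftrightarrow>
     (\<forall>t\<in>{1..T}. \<forall>s\<in>{1..S}. \<forall>a\<in>{1..A}.
        u t s a \<in> {\<phi> t s a 0..\<phi> t s a (total_mass T S p)}) \<and>
     (\<forall>t\<in>{1..T}. \<forall>s\<in>{1..S}. w t s \<in> {\<psi> t s 0..\<psi> t s (total_mass T S p)}) \<and>
     (\<forall>s\<in>{1..S}. \<forall>a\<in>{1..A}. v T s \<le> u T s a) \<and>
     (\<forall>t\<in>{1..<T}. \<forall>s\<in>{1..S}. \<forall>a\<in>{1..A}.
        v t s \<le> u t s a + (\<Sum>s'\<in>{1..S}. P s a s' * v (t + 1) s')) \<and>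
     (\<forall>t\<in>{1..T}. \<forall>s\<in>{1..S}. v t s \<le> w t s + l t s \<and> 0 \<le> l t s)"

definition dual_objective ::
  "nat \<Rightarrow> nat \<Rightarrow> nat \<Rightarrow> (nat \<Rightarrow> nat \<Rightarrow> real)
    \<Rightarrow> (nat \<Rightarrow> nat \<Rightarrow> nat \<Rightarrow> real \<Rightarrow> real) \<Rightarrow> (nat \<Rightarrow> nat \<Rightarrow> real \<Rightarrow> real)
    \<Rightarrow> (nat \<Rightarrow> nat \<Rightarrow> nat \<Rightarrow> real) \<Rightarrow> (nat \<Rightarrow> nat \<Rightarrow> real) \<Rightarrow> (nat \<Rightarrow> nat \<Rightarrow> real)
    \<Rightarrow> (nat \<Rightarrow> nat \<Rightarrow> real) \<Rightarrow> real" where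
  "dual_objective T S A p \<phi> \<psi> u v w l =
     (\<Sum>t\<in>{1..T}. \<Sum>s\<in>{1..S}. p t s * (v t s - l t s)) -
     (\<Sum>t\<in>{1..T}. \<Sum>s\<in>{1..S}. \<Sum>a\<in>{1..A}.
        integral {\<phi> t s a 0..u t s a} (inv_into {0..total_mass T S p} (\<phi> t s a))) -
     (\<Sum>t\<in>{1..T}. \<Sum>s\<in>{1..S}.
        integral {\<psi> t s 0..w t s} (inv_into {0..total_mass T S p} (\<psi> t s)))"

definition dual_optimal ::
  "nat \<Rightarrow> nat \<Rightarrow> nat \<Rightarrow> (nat \<Rightarrow> nat \<Rightarrow> real) \<Rightarrow> (nat \<Rightarrow> nat \<Rightarrow> nat \<Rightarrow> real)
    \<Rightarrow> (nat \<Rightarrow> nat \<Rightarrow> nat \<Rightarrow> real \<Rightarrow> real) \<Rightarrow> (nat \<Rightarrow> nat \<Rightarrow> real \<Rightarrow> real)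
    \<Rightarrow> (nat \<Rightarrow> nat \<Rightarrow> nat \<Rightarrow> real) \<Rightarrow> (nat \<Rightarrow> nat \<Rightarrow> real) \<Rightarrow> (nat \<Rightarrow> nat \<Rightarrow> real)
    \<Rightarrow> (nat \<Rightarrow> nat \<Rightarrow> real) \<Rightarrow> bool" where
  "dual_optimal T S A p P \<phi> \<psi> u v w l \<longleftrightarrow>
     is_arg_max (\<lambda>(u, v, w, l). dual_objective T S A p \<phi> \<psi> u v w l)
       (\<lambda>(u, v, w, l). dual_feasible T S A p P \<phi> \<psi> u v w l) (u, v, w, l)"

end

theory Submission
  imports Defs
begin

text \<open>
  The conclusions are the complementary slackness conditions of the convex pair (P), (D), so the
  point is that the two optimal values agree, with the dual variables \<open>u\<close> and \<open>w\<close> confined to the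
  ranges of \<open>\<phi>\<close> and \<open>\<psi>\<close>.

  For feasible points of both problems, conservation of mass turns the primal value minus the dual
  value into a sum of the Young gaps of the pairs \<open>(y, u)\<close> and \<open>(z, w)\<close> and of the products of
  \<open>y\<close>, \<open>z\<close> and \<open>p - z\<close> with the slacks of the three dual constraints (lemma \<open>lagrangian_gap\<close>).
  Each term is nonnegative. If the total is zero, every term is zero: the equality case of Young's
  inequality (lemma \<open>Young_inequality\<close>) gives \<open>u = \<phi>(y)\<close> and \<open>w = \<psi>(z)\<close>, and the vanishing
  products yield the case distinctions of the theorem.

  That the gap closes at optimal points is shown without a minimax theorem. A primal optimum
  \<open>(y, z)\<close> also minimizes the linear functional with the constant unit costs \<open>c = \<phi>(y)\<close>,
  \<open>d = \<psi>(z)\<close> over the feasible set (lemma \<open>first_order_optimality\<close>). This linear program is a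
  finite-horizon Markov decision problem in which the external supply \<open>p\<close> may also be turned away
  at cost \<open>d\<close>. Backward induction yields its value function \<open>v\<close>. Turning supply away where
  \<open>d < v\<close>, and sending all other mass along minimizing actions, is a feasible flow whose cost
  equals the dual value of \<open>v\<close>
  (lemma \<open>linear_program_duality\<close>). Hence \<open>(c, v, d, max 0 (v - d))\<close> is feasible for (D), and its
  dual objective is at least the primal optimum (lemma \<open>no_duality_gap\<close>). Mass conservation bounds
  \<open>y\<close> and \<open>z\<close> by the total mass, which puts \<open>c\<close> and \<open>d\<close> in the required ranges.
\<close>

section \<open>Young's inequality for an increasing function and its inverse\<close>

text \<open>
  An antiderivative of an increasing function is convex, with that function as a subgradient.
\<close>
lemma integral_above_tangent:
  fixes f :: "real \<Rightarrow> real"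
  assumes cont: "continuous_on {c..d} f" and mono: "mono_on {c..d} f"
    and a: "a \<in> {c..d}" and b: "b \<in> {c..d}"
  shows "f a * (b - a) \<le> integral {c..b} f - integral {c..a} f"
proof (cases "a \<le> b")
  case True
  have "f integrable_on {c..b}"
    by (rule integrable_continuous_real, rule continuous_on_subset[OF cont]) (use b in auto)
  then have "integral {c..a} f + integral {a..b} f = integral {c..b} f"
    using a True by (intro Henstock_Kurzweil_Integration.integral_combine) auto
  moreover have "integral {a..b} (\<lambda>_. f a) \<le> integral {a..b} f"
  proof (rule integral_le)
    show "f integrable_on {a..b}"
      by (rule integrable_continuous_real, rule continuous_on_subset[OF cont]) (use a b in auto)
    show "f a \<le> f x" if "x \<in> {a..b}" for x
      using mono a b that by (auto intro: mono_onD)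
  qed auto
  ultimately show ?thesis using True by (simp add: algebra_simps)
next
  case False
  have "f integrable_on {c..a}"
    by (rule integrable_continuous_real, rule continuous_on_subset[OF cont]) (use a in auto)
  then have "integral {c..b} f + integral {b..a} f = integral {c..a} f"
    using b False by (intro Henstock_Kurzweil_Integration.integral_combine) auto
  moreover have "integral {b..a} f \<le> integral {b..a} (\<lambda>_. f a)"
  proof (rule integral_le)
    show "f integrable_on {b..a}"
      by (rule integrable_continuous_real, rule continuous_on_subset[OF cont]) (use a b in auto)
    show "f x \<le> f a" if "x \<in> {b..a}" for x
      using mono a b that by (auto intro: mono_onD)
  qed auto
  ultimately show ?thesis using False by (simp add: algebra_simps)
qed

lemma integral_above_tangent_strict:
  fixes f :: "real \<Rightarrow> real"
  assumes cont: "continuous_on {c..d} f" and mono: "strict_mono_on {c..d} f"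
    and a: "a \<in> {c..d}" and b: "b \<in> {c..d}" and "a \<noteq> b"
  shows "f a * (b - a) < integral {c..b} f - integral {c..a} f"
proof -
  \<comment> \<open>Two tangent steps via the midpoint gain over one step, because the slope at the midpoint differs.\<close>
  let ?m = "(a + b) / 2"
  have m: "?m \<in> {c..d}" using a b by auto
  note tan = integral_above_tangent[OF cont strict_mono_on_imp_mono_on[OF mono]]
  have "0 < (f ?m - f a) * (b - ?m)"
  proof (cases "a < b")
    case True
    then have "f a < f ?m" using a m by (intro strict_mono_onD[OF mono]) auto
    with True show ?thesis by (intro mult_pos_pos) auto
  next
    case False
    with \<open>a \<noteq> b\<close> have "f ?m < f a" using a m by (intro strict_mono_onD[OF mono]) auto
    with False \<open>a \<noteq> b\<close> show ?thesis by (intro mult_neg_neg) auto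
  qed
  then have "f a * (b - a) < f a * (?m - a) + f ?m * (b - ?m)" by (simp add: field_simps)
  with tan[OF a m] tan[OF m b] show ?thesis by linarith
qed

text \<open>
  The areas under \<open>f\<close> and under its inverse fill the rectangle with sides \<open>x\<close> and \<open>f x\<close>, up to
  the shift by \<open>f 0\<close>. Since \<open>f\<close> need not be differentiable, the derivative of the difference \<open>D\<close>
  of both sides is not computed by rules. Instead the tangent bounds for \<open>f\<close> and for its inverse
  give \<open>\<bar>D b - D a\<bar> \<le> \<bar>f b - f a\<bar> * \<bar>b - a\<bar>\<close>, so \<open>D\<close> has derivative zero by continuity
  of \<open>f\<close>.
\<close>
lemma Young_equality:
  fixes f :: "real \<Rightarrow> real"
  assumes cont: "continuous_on {0..r} f" and mono: "strict_mono_on {0..r} f"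
    and x: "x \<in> {0..r}"
  shows "integral {0..x} f + integral {f 0..f x} (inv_into {0..r} f) = x * f x"
proof -
  define g where "g = inv_into {0..r} f"
  define D where "D x = integral {0..x} f + integral {f 0..f x} g - x * f x" for x
  have r: "0 \<le> r" using x by simp
  have inj: "inj_on f {0..r}" using mono by (rule strict_mono_on_imp_inj_on)
  have fmono: "mono_on {0..r} f" using mono by (rule strict_mono_on_imp_mono_on)
  have gf: "g (f a) = a" if "a \<in> {0..r}" for a
    unfolding g_def using inj that by (rule inv_into_f_f)
  have fin: "f a \<in> {f 0..f r}" if "a \<in> {0..r}" for a
    using that r by (auto intro: mono_onD[OF fmono])
  have img: "f ` {0..r} = {f 0..f r}"
  proof
    show "f ` {0..r} \<subseteq> {f 0..f r}" using fin by auto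
    show "{f 0..f r} \<subseteq> f ` {0..r}"
    proof
      fix q assume "q \<in> {f 0..f r}"
      then obtain a where "0 \<le> a" "a \<le> r" "f a = q" using IVT'[of f 0 q r] cont r by auto
      then show "q \<in> f ` {0..r}" by auto
    qed
  qed
  have gcont: "continuous_on {f 0..f r} g"
    unfolding img[symmetric] by (rule continuous_on_inv[OF cont]) (auto simp: gf)
  have gmono: "mono_on {f 0..f r} g"
  proof (rule mono_onI)
    fix i j assume "i \<in> {f 0..f r}" "j \<in> {f 0..f r}" "i \<le> j"
    then obtain a b where "a \<in> {0..r}" "b \<in> {0..r}" "i = f a" "j = f b"
      unfolding img[symmetric] by auto
    then have "a \<le> b" using \<open>i \<le> j\<close> strict_mono_onD[OF mono, of b a] by fastforce
    then show "g i \<le> g j"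
      using gf \<open>a \<in> {0..r}\<close> \<open>b \<in> {0..r}\<close> \<open>i = f a\<close> \<open>j = f b\<close> by simp
  qed
  have up: "D b - D a \<le> \<bar>f b - f a\<bar> * \<bar>b - a\<bar>" if a: "a \<in> {0..r}" and b: "b \<in> {0..r}" for a b
  proof -
    have "f b * (a - b) \<le> integral {0..a} f - integral {0..b} f"
      by (rule integral_above_tangent[OF cont fmono b a])
    moreover have "b * (f a - f b) \<le> integral {f 0..f a} g - integral {f 0..f b} g"
      using integral_above_tangent[OF gcont gmono fin[OF b] fin[OF a]] gf[OF b] by simp
    ultimately have "D b - D a \<le> (f b - f a) * (b - a)"
      unfolding D_def by (simp add: algebra_simps)
    also have "\<dots> \<le> \<bar>f b - f a\<bar> * \<bar>b - a\<bar>" by (metis abs_ge_self abs_mult)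
    finally show ?thesis .
  qed
  have deriv: "(D has_field_derivative 0) (at a within {0..r})" if a: "a \<in> {0..r}" for a
    unfolding has_field_derivative_iff
  proof (rule Lim_null_comparison)
    show "\<forall>\<^sub>F b in at a within {0..r}. norm ((D b - D a) / (b - a)) \<le> \<bar>f b - f a\<bar>"
      unfolding eventually_at_filter
    proof (intro always_eventually allI impI)
      fix b assume "b \<noteq> a" "b \<in> {0..r}"
      then show "norm ((D b - D a) / (b - a)) \<le> \<bar>f b - f a\<bar>"
        using up[OF a, of b] up[OF _ a, of b]
        by (simp add: abs_divide divide_le_eq abs_le_iff abs_minus_commute)
    qed
    have "(f \<longlongrightarrow> f a) (at a within {0..r})" using cont a by (simp add: continuous_on_def)
    from tendsto_rabs[OF tendsto_diff[OF this tendsto_const[of "f a"]]]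
    show "((\<lambda>b. \<bar>f b - f a\<bar>) \<longlongrightarrow> 0) (at a within {0..r})" by simp
  qed
  have "\<exists>c. \<forall>a\<in>{0..r}. D a = c"
    using deriv by (intro has_field_derivative_zero_constant) auto
  then have "D x = D 0" using x r by force
  then show ?thesis by (simp add: D_def g_def)
qed

text \<open>
  Writing \<open>u = f b\<close>, the equality above at \<open>b\<close> turns the Young gap into the distance at \<open>x\<close> between
  the antiderivative of \<open>f\<close> and its tangent at \<open>b\<close>. It vanishes only for \<open>x = b\<close>.
\<close>
lemma Young_inequality:
  fixes f :: "real \<Rightarrow> real"
  assumes cont: "continuous_on {0..r} f" and mono: "strict_mono_on {0..r} f"
    and x: "x \<in> {0..r}" and u: "u \<in> {f 0..f r}"
  shows "x * u \<le> integral {0..x} f + integral {f 0..u} (inv_into {0..r} f)"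
    and "x * u = integral {0..x} f + integral {f 0..u} (inv_into {0..r} f) \<Longrightarrow> u = f x"
proof -
  obtain b where b: "b \<in> {0..r}" and fb: "u = f b"
    using IVT'[of f 0 u r] cont x u by auto
  have "integral {0..x} f + integral {f 0..u} (inv_into {0..r} f) - x * u
      = integral {0..x} f - integral {0..b} f - f b * (x - b)"
    using Young_equality[OF cont mono b] fb by (simp add: algebra_simps)
  then show "x * u \<le> integral {0..x} f + integral {f 0..u} (inv_into {0..r} f)"
      and "x * u = integral {0..x} f + integral {f 0..u} (inv_into {0..r} f) \<Longrightarrow> u = f x"
    using integral_above_tangent[OF cont strict_mono_on_imp_mono_on[OF mono] b x]
      integral_above_tangent_strict[OF cont mono b x] fb by force+
qed

section \<open>Flows and their Lagrangian\<close>

locale network =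
  fixes T S A :: nat and p :: "nat \<Rightarrow> nat \<Rightarrow> real" and P :: "nat \<Rightarrow> nat \<Rightarrow> nat \<Rightarrow> real"
  assumes T_pos: "0 < T" and A_pos: "0 < A"
    and p_nonneg: "\<lbrakk>t \<in> {1..T}; s \<in> {1..S}\<rbrakk> \<Longrightarrow> 0 \<le> p t s"
    and P_nonneg: "\<lbrakk>s \<in> {1..S}; a \<in> {1..A}; s' \<in> {1..S}\<rbrakk> \<Longrightarrow> 0 \<le> P s a s'"
    and P_sum: "\<lbrakk>s \<in> {1..S}; a \<in> {1..A}\<rbrakk> \<Longrightarrow> (\<Sum>s'\<in>{1..S}. P s a s') = 1"
begin

abbreviation \<rho> :: real where "\<rho> \<equiv> total_mass T S p"

abbreviation feasible :: "(nat \<Rightarrow> nat \<Rightarrow> nat \<Rightarrow> real) \<Rightarrow> (nat \<Rightarrow> nat \<Rightarrow> real) \<Rightarrow> bool" where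
  "feasible \<equiv> primal_feasible T S A p P"

text \<open>
  The value zero at the horizon lets the last period share the formulas of the others, as the value
  zero of \<open>inflow\<close> at time 1 does for the first period.
\<close>
definition future :: "(nat \<Rightarrow> nat \<Rightarrow> real) \<Rightarrow> nat \<Rightarrow> nat \<Rightarrow> nat \<Rightarrow> real" where
  "future v t s a = (if t < T then \<Sum>s'\<in>{1..S}. P s a s' * v (t + 1) s' else 0)"

definition inflow :: "(nat \<Rightarrow> nat \<Rightarrow> nat \<Rightarrow> real) \<Rightarrow> nat \<Rightarrow> nat \<Rightarrow> real" where
  "inflow y t s = (if t = 1 then 0 else \<Sum>s'\<in>{1..S}. \<Sum>a\<in>{1..A}. P s' a s * y (t - 1) s' a)"

lemma split_off_first: "(\<forall>t\<in>{1..T}. Q t) \<longleftrightarrow> Q 1 \<and> (\<forall>t\<in>{1..<T}. Q (t + 1))"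
proof safe
  fix t assume Q: "Q 1" "\<forall>t\<in>{1..<T}. Q (t + 1)" and "t \<in> {1..T}"
  then show "Q t"
    by (cases t; cases "t = 1") auto
qed (use T_pos in auto)

lemma feasible_iff:
  "feasible y z \<longleftrightarrow>
     (\<forall>t\<in>{1..T}. \<forall>s\<in>{1..S}. (\<Sum>a\<in>{1..A}. y t s a) = p t s - z t s + inflow y t s) \<and>
     (\<forall>t\<in>{1..T}. \<forall>s\<in>{1..S}. \<forall>a\<in>{1..A}. 0 \<le> y t s a) \<and>
     (\<forall>t\<in>{1..T}. \<forall>s\<in>{1..S}. 0 \<le> z t s \<and> z t s \<le> p t s)"
  unfolding primal_feasible_def
    split_off_first[of "\<lambda>t. \<forall>s\<in>{1..S}. (\<Sum>a\<in>{1..A}. y t s a) = p t s - z t s + inflow y t s"]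
  by (simp add: inflow_def conj_assoc)

text \<open>
  The transition operator on flows is adjoint to the one on value functions.
\<close>
lemma sum_inflow_eq_sum_future:
  "(\<Sum>t\<in>{1..T}. \<Sum>s\<in>{1..S}. v t s * inflow y t s)
     = (\<Sum>t\<in>{1..T}. \<Sum>s\<in>{1..S}. \<Sum>a\<in>{1..A}. y t s a * future v t s a)"
proof -
  have step: "(\<Sum>s\<in>{1..S}. v (Suc t) s * inflow y (Suc t) s)
      = (\<Sum>s\<in>{1..S}. \<Sum>a\<in>{1..A}. y t s a * future v t s a)" if "t \<in> {1..<T}" for t
  proof -
    have "(\<Sum>s\<in>{1..S}. v (Suc t) s * inflow y (Suc t) s)
        = (\<Sum>s\<in>{1..S}. \<Sum>s'\<in>{1..S}. \<Sum>a\<in>{1..A}. v (Suc t) s * (P s' a s * y t s' a))"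
      using that by (simp add: inflow_def sum_distrib_left)
    also have "\<dots> = (\<Sum>s'\<in>{1..S}. \<Sum>s\<in>{1..S}. \<Sum>a\<in>{1..A}. v (Suc t) s * (P s' a s * y t s' a))"
      by (rule sum.swap)
    also have "\<dots> = (\<Sum>s'\<in>{1..S}. \<Sum>a\<in>{1..A}. \<Sum>s\<in>{1..S}. v (Suc t) s * (P s' a s * y t s' a))"
      by (intro sum.cong refl sum.swap)
    also have "\<dots> = (\<Sum>s\<in>{1..S}. \<Sum>a\<in>{1..A}. y t s a * future v t s a)"
      using that by (simp add: future_def sum_distrib_left mult_ac)
    finally show ?thesis .
  qed
  have "(\<Sum>t\<in>{1..T}. \<Sum>s\<in>{1..S}. v t s * inflow y t s)
      = (\<Sum>t\<in>{Suc 1..T}. \<Sum>s\<in>{1..S}. v t s * inflow y t s)"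
    using T_pos by (subst sum.atLeast_Suc_atMost) (auto simp: inflow_def)
  also have "\<dots> = (\<Sum>t\<in>{1..<T}. \<Sum>s\<in>{1..S}. v (Suc t) s * inflow y (Suc t) s)"
    by (rule sum.reindex_bij_witness[where i = Suc and j = "\<lambda>t. t - 1"]) auto
  also have "\<dots> = (\<Sum>t\<in>{1..<T}. \<Sum>s\<in>{1..S}. \<Sum>a\<in>{1..A}. y t s a * future v t s a)"
    using step by (rule sum.cong[OF refl])
  also have "\<dots> = (\<Sum>t\<in>{1..T}. \<Sum>s\<in>{1..S}. \<Sum>a\<in>{1..A}. y t s a * future v t s a)"
    by (rule sum.mono_neutral_left) (auto simp: future_def)
  finally show ?thesis .
qed

text \<open>
  Weak duality in exact form: if \<open>v\<close> and \<open>l\<close> satisfy the dual constraints with \<open>c\<close>, \<open>d\<close> in place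
  of \<open>u\<close>, \<open>w\<close>, each product on the right has two nonnegative factors. The identity comes from
  weighting the balance equations with \<open>v\<close> and summing.
\<close>
lemma lagrangian_gap:
  assumes "feasible y z"
  shows "(\<Sum>t\<in>{1..T}. \<Sum>s\<in>{1..S}. \<Sum>a\<in>{1..A}. c t s a * y t s a)
      + (\<Sum>t\<in>{1..T}. \<Sum>s\<in>{1..S}. d t s * z t s)
      - (\<Sum>t\<in>{1..T}. \<Sum>s\<in>{1..S}. p t s * (v t s - l t s))
    = (\<Sum>t\<in>{1..T}. \<Sum>s\<in>{1..S}. (\<Sum>a\<in>{1..A}. y t s a * (c t s a + future v t s a - v t s))
         + z t s * (d t s + l t s - v t s) + (p t s - z t s) * l t s)"
proof -
  have balance: "p t s = z t s - inflow y t s + (\<Sum>a\<in>{1..A}. y t s a)"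
    if "t \<in> {1..T}" "s \<in> {1..S}" for t s
    using assms that unfolding feasible_iff by force
  have "(\<Sum>t\<in>{1..T}. \<Sum>s\<in>{1..S}. p t s * v t s)
      = (\<Sum>t\<in>{1..T}. \<Sum>s\<in>{1..S}. (\<Sum>a\<in>{1..A}. y t s a * v t s) + z t s * v t s - v t s * inflow y t s)"
    by (intro sum.cong refl, subst balance) (auto simp: algebra_simps sum_distrib_left)
  also have "\<dots> = (\<Sum>t\<in>{1..T}. \<Sum>s\<in>{1..S}. (\<Sum>a\<in>{1..A}. y t s a * (v t s - future v t s a)) + z t s * v t s)"
    by (simp add: sum_subtractf sum.distrib sum_inflow_eq_sum_future right_diff_distrib del: One_nat_def)
  finally show ?thesis
    by (simp add: sum_subtractf sum.distrib algebra_simps)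
qed

lemma rho_nonneg: "0 \<le> \<rho>"
  unfolding total_mass_def by (intro sum_nonneg p_nonneg)

text \<open>
  Transitions preserve mass, since \<open>P\<close> is stochastic, so at time \<open>t\<close> at most the mass that has
  entered so far is present.
\<close>
lemma feasible_mass_bound:
  assumes yz: "feasible y z" and "t \<in> {1..T}"
  shows "(\<Sum>s\<in>{1..S}. \<Sum>a\<in>{1..A}. y t s a) \<le> (\<Sum>t\<in>{1..t}. \<Sum>s\<in>{1..S}. p t s)"
  using \<open>t \<in> {1..T}\<close>
proof (induction t)
  case (Suc t)
  have "(\<Sum>s\<in>{1..S}. \<Sum>a\<in>{1..A}. y (Suc t) s a)
      = (\<Sum>s\<in>{1..S}. p (Suc t) s - z (Suc t) s + inflow y (Suc t) s)"
    using yz Suc.prems unfolding feasible_iff by (intro sum.cong) auto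
  also have "\<dots> \<le> (\<Sum>s\<in>{1..S}. p (Suc t) s + inflow y (Suc t) s)"
    using yz Suc.prems unfolding feasible_iff by (intro sum_mono) auto
  finally have le: "(\<Sum>s\<in>{1..S}. \<Sum>a\<in>{1..A}. y (Suc t) s a)
      \<le> (\<Sum>s\<in>{1..S}. p (Suc t) s) + (\<Sum>s\<in>{1..S}. inflow y (Suc t) s)"
    by (simp add: sum.distrib)
  show ?case
  proof (cases "t = 0")
    case True
    with le show ?thesis by (simp add: inflow_def)
  next
    case False
    have "(\<Sum>s\<in>{1..S}. inflow y (Suc t) s)
        = (\<Sum>s\<in>{1..S}. \<Sum>s'\<in>{1..S}. \<Sum>a\<in>{1..A}. P s' a s * y t s' a)"
      using False by (simp add: inflow_def)
    also have "\<dots> = (\<Sum>s'\<in>{1..S}. \<Sum>s\<in>{1..S}. \<Sum>a\<in>{1..A}. P s' a s * y t s' a)"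
      by (rule sum.swap)
    also have "\<dots> = (\<Sum>s'\<in>{1..S}. \<Sum>a\<in>{1..A}. \<Sum>s\<in>{1..S}. P s' a s * y t s' a)"
      by (intro sum.cong refl sum.swap)
    also have "\<dots> = (\<Sum>s'\<in>{1..S}. \<Sum>a\<in>{1..A}. y t s' a)"
      using P_sum by (simp flip: sum_distrib_right)
    finally show ?thesis using le Suc False by simp
  qed
qed simp

lemma feasible_range:
  assumes yz: "feasible y z" and t: "t \<in> {1..T}" and s: "s \<in> {1..S}"
  shows "a \<in> {1..A} \<Longrightarrow> y t s a \<in> {0..\<rho>}" and "z t s \<in> {0..\<rho>}" and "p t s \<in> {0..\<rho>}"
proof -
  have y0: "0 \<le> y t s a" if "s \<in> {1..S}" "a \<in> {1..A}" for s a
    using yz t that unfolding feasible_iff by auto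
  have "y t s a \<le> (\<Sum>a\<in>{1..A}. y t s a)" if "a \<in> {1..A}" for a
    using that y0 s by (intro member_le_sum) auto
  moreover have "(\<Sum>a\<in>{1..A}. y t s a) \<le> (\<Sum>s\<in>{1..S}. \<Sum>a\<in>{1..A}. y t s a)"
    using y0 s by (intro member_le_sum[where f = "\<lambda>s. \<Sum>a\<in>{1..A}. y t s a"] sum_nonneg) auto
  moreover have "(\<Sum>t\<in>{1..t}. \<Sum>s\<in>{1..S}. p t s) \<le> \<rho>"
    unfolding total_mass_def using t p_nonneg by (intro sum_mono2 sum_nonneg) auto
  ultimately show "y t s a \<in> {0..\<rho>}" if "a \<in> {1..A}"
    using feasible_mass_bound[OF yz t] y0[OF s that] that by fastforce
  have "p t s \<le> (\<Sum>s\<in>{1..S}. p t s)"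
    using p_nonneg s t by (intro member_le_sum) auto
  also have "\<dots> \<le> \<rho>" unfolding total_mass_def
    using p_nonneg t by (intro member_le_sum[where f = "\<lambda>t. \<Sum>s\<in>{1..S}. p t s"] sum_nonneg) auto
  finally show pr: "p t s \<in> {0..\<rho>}" using p_nonneg[OF t s] by simp
  show "z t s \<in> {0..\<rho>}" using pr yz s t unfolding feasible_iff by fastforce
qed

section \<open>Linear costs: dynamic programming\<close>

text \<open>
  The first numerical argument is the number of periods left, so that the backward recursion from
  time \<open>T\<close> is primitive recursive.
\<close>
primrec cost_to_go :: "(nat \<Rightarrow> nat \<Rightarrow> nat \<Rightarrow> real) \<Rightarrow> nat \<Rightarrow> nat \<Rightarrow> real" where
  "cost_to_go c 0 s = Min ((\<lambda>a. c T s a) ` {1..A})"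
| "cost_to_go c (Suc k) s
     = Min ((\<lambda>a. c (T - Suc k) s a + (\<Sum>s'\<in>{1..S}. P s a s' * cost_to_go c k s')) ` {1..A})"

lemma bellman_equation:
  assumes "t \<in> {1..T}"
  shows "cost_to_go c (T - t) s
    = Min ((\<lambda>a. c t s a + future (\<lambda>t. cost_to_go c (T - t)) t s a) ` {1..A})"
proof (cases "T - t")
  case 0
  with assms have "t = T" by simp
  then show ?thesis by (simp add: future_def)
next
  case (Suc k)
  with assms have "t < T" "T - Suc k = t" "T - (t + 1) = k" by auto
  then show ?thesis unfolding Suc by (simp add: future_def)
qed

text \<open>
  Mass that acts in state \<open>s\<close> at time \<open>t\<close>, if net supply \<open>x\<close> enters and everything present
  follows the policy \<open>g\<close>. No mass is present at time 0, so \<open>P\<close> contributes nothing at time 1.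
\<close>
primrec throughput :: "(nat \<Rightarrow> nat \<Rightarrow> nat) \<Rightarrow> (nat \<Rightarrow> nat \<Rightarrow> real) \<Rightarrow> nat \<Rightarrow> nat \<Rightarrow> real" where
  "throughput g x 0 s = 0"
| "throughput g x (Suc t) s = x (Suc t) s +
     (\<Sum>s'\<in>{1..S}. \<Sum>a\<in>{1..A}. P s' a s * (if a = g t s' then throughput g x t s' else 0))"

lemma feasible_policy_flow:
  assumes g: "\<And>t s. \<lbrakk>t \<in> {1..T}; s \<in> {1..S}\<rbrakk> \<Longrightarrow> g t s \<in> {1..A}"
    and z: "\<And>t s. \<lbrakk>t \<in> {1..T}; s \<in> {1..S}\<rbrakk> \<Longrightarrow> 0 \<le> z t s \<and> z t s \<le> p t s"
  defines "y \<equiv> \<lambda>t s a. if a = g t s then throughput g (\<lambda>t s. p t s - z t s) t s else 0"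
  shows "feasible y z"
proof -
  let ?m = "throughput g (\<lambda>t s. p t s - z t s)"
  have m0: "0 \<le> ?m t s" if "t \<le> T" "s \<in> {1..S}" for t s
    using that
  proof (induction t arbitrary: s)
    case (Suc t)
    then show ?case
      using z[of "Suc t" s] by (auto intro!: add_nonneg_nonneg sum_nonneg mult_nonneg_nonneg P_nonneg)
  qed simp
  have rec: "?m t s = p t s - z t s + inflow y t s" if "t \<in> {1..T}" for t s
  proof (cases t)
    case (Suc k)
    then show ?thesis by (cases k) (simp_all add: inflow_def y_def cong: if_cong)
  qed (use that in simp)
  have "(\<Sum>a\<in>{1..A}. y t s a) = ?m t s" if "t \<in> {1..T}" "s \<in> {1..S}" for t s
    using g[OF that] by (simp add: y_def)
  then have "(\<Sum>a\<in>{1..A}. y t s a) = p t s - z t s + inflow y t s" if "t \<in> {1..T}" "s \<in> {1..S}" for t s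
    using rec that by simp
  moreover have "0 \<le> y t s a" if "t \<in> {1..T}" "s \<in> {1..S}" for t s a
    using m0[of t s] that unfolding y_def by auto
  ultimately show ?thesis using z unfolding feasible_iff by blast
qed

text \<open>
  The linear program is solved by dynamic programming: \<open>v\<close> is its value function, and the flow \<open>y\<close>
  uses only actions that attain the minimum in the Bellman equation. The supply is turned away
  exactly where this is cheaper than letting it flow on. These choices make every summand of the Lagrangian
  gap vanish. The price \<open>max 0 (v - d)\<close> is the least feasible multiplier of the constraint
  \<open>z \<le> p\<close>.
\<close>
lemma linear_program_duality:
  obtains v y z where "feasible y z"
    and "\<And>t s a. \<lbrakk>t \<in> {1..T}; s \<in> {1..S}; a \<in> {1..A}\<rbrakk> \<Longrightarrow> v t s \<le> c t s a + future v t s a"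
    and "(\<Sum>t\<in>{1..T}. \<Sum>s\<in>{1..S}. \<Sum>a\<in>{1..A}. c t s a * y t s a)
        + (\<Sum>t\<in>{1..T}. \<Sum>s\<in>{1..S}. d t s * z t s)
      = (\<Sum>t\<in>{1..T}. \<Sum>s\<in>{1..S}. p t s * (v t s - max 0 (v t s - d t s)))"
proof -
  define v where "v t s = cost_to_go c (T - t) s" for t s
  define q where "q t s a = c t s a + future v t s a" for t s a
  have v_min: "v t s = Min (q t s ` {1..A})" if "t \<in> {1..T}" for t s
    using bellman_equation[OF that, of c s] unfolding v_def[abs_def] q_def[abs_def] by simp
  have v_le: "v t s \<le> q t s a" if "t \<in> {1..T}" "a \<in> {1..A}" for t s a
    using that by (simp add: v_min)
  have "\<exists>a\<in>{1..A}. v t s = q t s a" if "t \<in> {1..T}" for t s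
  proof -
    have "Min (q t s ` {1..A}) \<in> q t s ` {1..A}" using A_pos by (intro Min_in) auto
    then show ?thesis using v_min[OF that] by auto
  qed
  then obtain g where g: "\<And>t s. t \<in> {1..T} \<Longrightarrow> g t s \<in> {1..A} \<and> v t s = q t s (g t s)"
    by metis
  define z where "z t s = (if d t s < v t s then p t s else 0)" for t s
  define y where "y t s a = (if a = g t s then throughput g (\<lambda>t s. p t s - z t s) t s else 0)" for t s a
  have "feasible y z" unfolding y_def[abs_def]
    using g p_nonneg by (intro feasible_policy_flow) (auto simp: z_def)
  moreover have "y t s a * (c t s a + future v t s a - v t s) = 0" if "t \<in> {1..T}" for t s a
    using g[OF that] by (simp add: y_def q_def)
  then have "(\<Sum>t\<in>{1..T}. \<Sum>s\<in>{1..S}. \<Sum>a\<in>{1..A}. c t s a * y t s a)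
        + (\<Sum>t\<in>{1..T}. \<Sum>s\<in>{1..S}. d t s * z t s)
      = (\<Sum>t\<in>{1..T}. \<Sum>s\<in>{1..S}. p t s * (v t s - max 0 (v t s - d t s)))"
    using lagrangian_gap[OF \<open>feasible y z\<close>, of c d v "\<lambda>t s. max 0 (v t s - d t s)"]
    by (simp add: z_def max_def sum.neutral)
  ultimately show thesis using v_le that[of y z v] unfolding q_def by blast
qed

section \<open>Strong duality and complementary slackness\<close>

lemma feasible_convex:
  assumes "feasible y z" "feasible y' z'" "e \<in> {0..1}"
  shows "feasible (\<lambda>t s a. y t s a + e * (y' t s a - y t s a)) (\<lambda>t s. z t s + e * (z' t s - z t s))"
proof -
  have infl: "inflow (\<lambda>t s a. y t s a + e * (y' t s a - y t s a)) t s
      = inflow y t s + e * (inflow y' t s - inflow y t s)" for t s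
    by (simp add: inflow_def algebra_simps sum.distrib sum_subtractf sum_distrib_left)
  have nonneg: "0 \<le> b + e * (b' - b)" if "0 \<le> b" "0 \<le> b'" for b b' :: real
  proof -
    have "0 \<le> (1 - e) * b + e * b'" using that assms(3) by simp
    then show ?thesis by (simp add: algebra_simps)
  qed
  show ?thesis
    unfolding feasible_iff infl
  proof (intro conjI ballI)
    fix t s assume ts: "t \<in> {1..T}" "s \<in> {1..S}"
    have bal: "(\<Sum>a\<in>{1..A}. y t s a) = p t s - z t s + inflow y t s"
      "(\<Sum>a\<in>{1..A}. y' t s a) = p t s - z' t s + inflow y' t s"
      using assms(1,2) ts unfolding feasible_iff by auto
    have "(\<Sum>a\<in>{1..A}. y t s a + e * (y' t s a - y t s a))
        = (\<Sum>a\<in>{1..A}. y t s a) + e * ((\<Sum>a\<in>{1..A}. y' t s a) - (\<Sum>a\<in>{1..A}. y t s a))"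
      by (simp add: sum.distrib sum_subtractf flip: sum_distrib_left)
    then show "(\<Sum>a\<in>{1..A}. y t s a + e * (y' t s a - y t s a))
        = p t s - (z t s + e * (z' t s - z t s)) + (inflow y t s + e * (inflow y' t s - inflow y t s))"
      unfolding bal by (simp add: algebra_simps)
    have "0 \<le> (p t s - z t s) + e * ((p t s - z' t s) - (p t s - z t s))"
      using assms(1,2) ts unfolding feasible_iff by (intro nonneg) auto
    then show "z t s + e * (z' t s - z t s) \<le> p t s" by (simp add: algebra_simps)
  qed (use assms(1,2) in \<open>auto simp: feasible_iff intro!: nonneg\<close>)
qed

end

locale congestion_network = network +
  fixes \<phi> :: "nat \<Rightarrow> nat \<Rightarrow> nat \<Rightarrow> real \<Rightarrow> real" and \<psi> :: "nat \<Rightarrow> nat \<Rightarrow> real \<Rightarrow> real"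
  assumes \<phi>_cont: "\<lbrakk>t \<in> {1..T}; s \<in> {1..S}; a \<in> {1..A}\<rbrakk> \<Longrightarrow> continuous_on {0..\<rho>} (\<phi> t s a)"
    and \<phi>_mono: "\<lbrakk>t \<in> {1..T}; s \<in> {1..S}; a \<in> {1..A}\<rbrakk> \<Longrightarrow> strict_mono_on {0..\<rho>} (\<phi> t s a)"
    and \<psi>_cont: "\<lbrakk>t \<in> {1..T}; s \<in> {1..S}\<rbrakk> \<Longrightarrow> continuous_on {0..\<rho>} (\<psi> t s)"
    and \<psi>_mono: "\<lbrakk>t \<in> {1..T}; s \<in> {1..S}\<rbrakk> \<Longrightarrow> strict_mono_on {0..\<rho>} (\<psi> t s)"
begin

lemma dual_feasible_iff:
  "dual_feasible T S A p P \<phi> \<psi> u v w l \<longleftrightarrow>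
     (\<forall>t\<in>{1..T}. \<forall>s\<in>{1..S}. \<forall>a\<in>{1..A}. u t s a \<in> {\<phi> t s a 0..\<phi> t s a \<rho>}) \<and>
     (\<forall>t\<in>{1..T}. \<forall>s\<in>{1..S}. w t s \<in> {\<psi> t s 0..\<psi> t s \<rho>}) \<and>
     (\<forall>t\<in>{1..T}. \<forall>s\<in>{1..S}. \<forall>a\<in>{1..A}. v t s \<le> u t s a + future v t s a) \<and>
     (\<forall>t\<in>{1..T}. \<forall>s\<in>{1..S}. v t s \<le> w t s + l t s \<and> 0 \<le> l t s)"
proof -
  have split_last: "{1..T} = insert T {1..<T}" using T_pos by auto
  have "(\<forall>t\<in>{1..T}. \<forall>s\<in>{1..S}. \<forall>a\<in>{1..A}. v t s \<le> u t s a + future v t s a) \<longleftrightarrow>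
      (\<forall>s\<in>{1..S}. \<forall>a\<in>{1..A}. v T s \<le> u T s a) \<and>
      (\<forall>t\<in>{1..<T}. \<forall>s\<in>{1..S}. \<forall>a\<in>{1..A}. v t s \<le> u t s a + (\<Sum>s'\<in>{1..S}. P s a s' * v (t + 1) s'))"
    unfolding split_last by (simp add: future_def)
  then show ?thesis unfolding dual_feasible_def by argo
qed

lemma primal_optimal_iff:
  "primal_optimal T S A p P \<phi> \<psi> y z \<longleftrightarrow> feasible y z \<and>
     (\<forall>y' z'. feasible y' z' \<longrightarrow> primal_objective T S A \<phi> \<psi> y z \<le> primal_objective T S A \<phi> \<psi> y' z')"
  unfolding primal_optimal_def is_arg_min_linorder split_paired_All case_prod_conv ..

lemma dual_optimal_iff:
  "dual_optimal T S A p P \<phi> \<psi> u v w l \<longleftrightarrow> dual_feasible T S A p P \<phi> \<psi> u v w l \<and>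
     (\<forall>u' v' w' l'. dual_feasible T S A p P \<phi> \<psi> u' v' w' l' \<longrightarrow>
        dual_objective T S A p \<phi> \<psi> u' v' w' l' \<le> dual_objective T S A p \<phi> \<psi> u v w l)"
  unfolding dual_optimal_def is_arg_max_linorder split_paired_All case_prod_conv ..

text \<open>
  Moving from the optimum a fraction \<open>e\<close> of the way to another feasible point cannot lower the
  objective. By convexity the increase is at most \<open>e\<close> times the linear functional with the costs
  taken at the new point, so that functional is nonnegative. Letting \<open>e\<close> tend to 0 moves the costs
  to the optimum, by continuity of \<open>\<phi>\<close> and \<open>\<psi>\<close>.
\<close>
lemma first_order_optimality:
  assumes opt: "primal_optimal T S A p P \<phi> \<psi> y z" and yz': "feasible y' z'"
  shows "0 \<le> (\<Sum>t\<in>{1..T}. \<Sum>s\<in>{1..S}. \<Sum>a\<in>{1..A}. \<phi> t s a (y t s a) * (y' t s a - y t s a))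
           + (\<Sum>t\<in>{1..T}. \<Sum>s\<in>{1..S}. \<psi> t s (z t s) * (z' t s - z t s))"
proof -
  define Y where "Y e t s a = y t s a + e * (y' t s a - y t s a)" for e t s a
  define Z where "Z e t s = z t s + e * (z' t s - z t s)" for e t s
  define D where "D e = (\<Sum>t\<in>{1..T}. \<Sum>s\<in>{1..S}. \<Sum>a\<in>{1..A}. \<phi> t s a (Y e t s a) * (y' t s a - y t s a))
      + (\<Sum>t\<in>{1..T}. \<Sum>s\<in>{1..S}. \<psi> t s (Z e t s) * (z' t s - z t s))" for e
  have yz: "feasible y z" using opt unfolding primal_optimal_iff by (rule conjunct1)
  have YZ: "feasible (Y e) (Z e)" if "e \<in> {0..1}" for e
    using feasible_convex[OF yz yz' that] unfolding Y_def[abs_def] Z_def[abs_def] .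
  have nonneg: "0 \<le> D e" if e: "e \<in> {0<..<1}" for e
  proof -
    have feas: "feasible (Y e) (Z e)" using e by (intro YZ) auto
    have "primal_objective T S A \<phi> \<psi> y z \<le> primal_objective T S A \<phi> \<psi> (Y e) (Z e)"
      using opt feas unfolding primal_optimal_iff by blast
    then have "0 \<le> (\<Sum>t\<in>{1..T}. \<Sum>s\<in>{1..S}. \<Sum>a\<in>{1..A}.
          integral {0..Y e t s a} (\<phi> t s a) - integral {0..y t s a} (\<phi> t s a))
        + (\<Sum>t\<in>{1..T}. \<Sum>s\<in>{1..S}. integral {0..Z e t s} (\<psi> t s) - integral {0..z t s} (\<psi> t s))"
      by (simp add: primal_objective_def sum_subtractf)
    also have "\<dots> \<le> (\<Sum>t\<in>{1..T}. \<Sum>s\<in>{1..S}. \<Sum>a\<in>{1..A}. \<phi> t s a (Y e t s a) * (Y e t s a - y t s a))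
        + (\<Sum>t\<in>{1..T}. \<Sum>s\<in>{1..S}. \<psi> t s (Z e t s) * (Z e t s - z t s))"
    proof (intro add_mono sum_mono)
      fix t s assume ts: "t \<in> {1..T}" "s \<in> {1..S}"
      show "integral {0..Z e t s} (\<psi> t s) - integral {0..z t s} (\<psi> t s) \<le> \<psi> t s (Z e t s) * (Z e t s - z t s)"
        using integral_above_tangent[OF \<psi>_cont[OF ts] strict_mono_on_imp_mono_on[OF \<psi>_mono[OF ts]]
            feasible_range(2)[OF feas ts] feasible_range(2)[OF yz ts]]
        by (simp add: algebra_simps)
      fix a assume a: "a \<in> {1..A}"
      show "integral {0..Y e t s a} (\<phi> t s a) - integral {0..y t s a} (\<phi> t s a)
          \<le> \<phi> t s a (Y e t s a) * (Y e t s a - y t s a)"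
        using integral_above_tangent[OF \<phi>_cont[OF ts a] strict_mono_on_imp_mono_on[OF \<phi>_mono[OF ts a]]
            feasible_range(1)[OF feas ts a] feasible_range(1)[OF yz ts a]]
        by (simp add: algebra_simps)
    qed
    also have "\<dots> = e * D e"
      unfolding D_def Y_def Z_def by (simp add: sum_distrib_left distrib_left mult_ac)
    finally show ?thesis using e by (simp add: zero_le_mult_iff)
  qed
  have "continuous_on {0..1} D"
    unfolding D_def
  proof (intro continuous_intros)
    fix t s assume ts: "t \<in> {1..T}" "s \<in> {1..S}"
    show "continuous_on {0..1} (\<lambda>e. \<psi> t s (Z e t s))"
      by (rule continuous_on_compose2[OF \<psi>_cont[OF ts]])
        (use feasible_range(2)[OF YZ ts] in \<open>auto simp: Z_def intro!: continuous_intros\<close>)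
    fix a assume a: "a \<in> {1..A}"
    show "continuous_on {0..1} (\<lambda>e. \<phi> t s a (Y e t s a))"
      by (rule continuous_on_compose2[OF \<phi>_cont[OF ts a]])
        (use feasible_range(1)[OF YZ ts a] in \<open>auto simp: Y_def intro!: continuous_intros\<close>)
  qed
  moreover have "closure {0<..<1::real} = {0..1}" by (rule closure_greaterThanLessThan) simp
  ultimately have "0 \<le> D 0"
    using continuous_ge_on_closure[of "{0<..<1}" D 0 0] nonneg by simp
  then show ?thesis by (simp add: D_def Y_def Z_def)
qed

text \<open>
  It suffices to exhibit one dual feasible point that is as good as the primal optimum. The costs at
  the optimum, with the value function of the linear program they define, give such a point: by the
  equality case of Young's inequality the two nonlinear objectives then differ exactly as those of
  the linear program do.
\<close>
lemma no_duality_gap: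
  assumes opt: "primal_optimal T S A p P \<phi> \<psi> y z"
    and dual: "dual_optimal T S A p P \<phi> \<psi> u v w l"
  shows "primal_objective T S A \<phi> \<psi> y z \<le> dual_objective T S A p \<phi> \<psi> u v w l"
proof -
  define c where "c t s a = \<phi> t s a (y t s a)" for t s a
  define d where "d t s = \<psi> t s (z t s)" for t s
  obtain V y' z' where feas': "feasible y' z'"
    and V: "\<And>t s a. \<lbrakk>t \<in> {1..T}; s \<in> {1..S}; a \<in> {1..A}\<rbrakk> \<Longrightarrow> V t s \<le> c t s a + future V t s a"
    and LP: "(\<Sum>t\<in>{1..T}. \<Sum>s\<in>{1..S}. \<Sum>a\<in>{1..A}. c t s a * y' t s a)
        + (\<Sum>t\<in>{1..T}. \<Sum>s\<in>{1..S}. d t s * z' t s)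
      = (\<Sum>t\<in>{1..T}. \<Sum>s\<in>{1..S}. p t s * (V t s - max 0 (V t s - d t s)))"
    by (rule linear_program_duality[of c d]) (rule that)
  define L where "L t s = max 0 (V t s - d t s)" for t s
  have yz: "feasible y z" using opt unfolding primal_optimal_iff by (rule conjunct1)
  have "dual_feasible T S A p P \<phi> \<psi> c V d L"
    unfolding dual_feasible_iff
  proof (intro conjI ballI)
    fix t s assume ts: "t \<in> {1..T}" "s \<in> {1..S}"
    show "V t s \<le> d t s + L t s" "0 \<le> L t s" by (auto simp: L_def)
    show "d t s \<in> {\<psi> t s 0..\<psi> t s \<rho>}"
      using feasible_range(2)[OF yz ts] rho_nonneg strict_mono_on_imp_mono_on[OF \<psi>_mono[OF ts]]
      unfolding d_def by (auto intro: mono_onD)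
    fix a assume a: "a \<in> {1..A}"
    show "c t s a \<in> {\<phi> t s a 0..\<phi> t s a \<rho>}"
      using feasible_range(1)[OF yz ts a] rho_nonneg strict_mono_on_imp_mono_on[OF \<phi>_mono[OF ts a]]
      unfolding c_def by (auto intro: mono_onD)
    show "V t s \<le> c t s a + future V t s a" by (rule V[OF ts a])
  qed
  then have "dual_objective T S A p \<phi> \<psi> c V d L \<le> dual_objective T S A p \<phi> \<psi> u v w l"
    using dual unfolding dual_optimal_iff by blast
  moreover have "primal_objective T S A \<phi> \<psi> y z \<le> dual_objective T S A p \<phi> \<psi> c V d L"
  proof -
    have "(\<Sum>t\<in>{1..T}. \<Sum>s\<in>{1..S}. \<Sum>a\<in>{1..A}. integral {\<phi> t s a 0..c t s a} (inv_into {0..\<rho>} (\<phi> t s a)))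
        = (\<Sum>t\<in>{1..T}. \<Sum>s\<in>{1..S}. \<Sum>a\<in>{1..A}. c t s a * y t s a - integral {0..y t s a} (\<phi> t s a))"
    proof (intro sum.cong refl)
      fix t s a assume tsa: "t \<in> {1..T}" "s \<in> {1..S}" "a \<in> {1..A}"
      show "integral {\<phi> t s a 0..c t s a} (inv_into {0..\<rho>} (\<phi> t s a))
          = c t s a * y t s a - integral {0..y t s a} (\<phi> t s a)"
        using Young_equality[OF \<phi>_cont[OF tsa] \<phi>_mono[OF tsa] feasible_range(1)[OF yz tsa]]
        by (simp add: c_def mult.commute)
    qed
    moreover have "(\<Sum>t\<in>{1..T}. \<Sum>s\<in>{1..S}. integral {\<psi> t s 0..d t s} (inv_into {0..\<rho>} (\<psi> t s)))
        = (\<Sum>t\<in>{1..T}. \<Sum>s\<in>{1..S}. d t s * z t s - integral {0..z t s} (\<psi> t s))"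
    proof (intro sum.cong refl)
      fix t s assume ts: "t \<in> {1..T}" "s \<in> {1..S}"
      show "integral {\<psi> t s 0..d t s} (inv_into {0..\<rho>} (\<psi> t s)) = d t s * z t s - integral {0..z t s} (\<psi> t s)"
        using Young_equality[OF \<psi>_cont[OF ts] \<psi>_mono[OF ts] feasible_range(2)[OF yz ts]]
        by (simp add: d_def mult.commute)
    qed
    moreover have "0 \<le> (\<Sum>t\<in>{1..T}. \<Sum>s\<in>{1..S}. \<Sum>a\<in>{1..A}. c t s a * y' t s a - c t s a * y t s a)
           + (\<Sum>t\<in>{1..T}. \<Sum>s\<in>{1..S}. d t s * z' t s - d t s * z t s)"
      using first_order_optimality[OF opt feas'] by (simp add: c_def d_def right_diff_distrib)
    ultimately show ?thesis
      using LP unfolding dual_objective_def primal_objective_def L_def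
      by (simp add: sum_subtractf)
  qed
  ultimately show ?thesis by simp
qed

text \<open>
  The primal value minus the dual value is the sum of the local gaps \<open>G\<close>, each a sum of nonnegative
  terms. Since the difference is at most zero, all these terms vanish.
\<close>
lemma complementary_slackness:
  assumes opt: "primal_optimal T S A p P \<phi> \<psi> y z"
    and dual: "dual_optimal T S A p P \<phi> \<psi> u v w l"
    and ts: "t \<in> {1..T}" "s \<in> {1..S}"
  shows "w t s = \<psi> t s (z t s)" "z t s * (w t s + l t s - v t s) = 0" "(p t s - z t s) * l t s = 0"
    and "a \<in> {1..A} \<Longrightarrow> u t s a = \<phi> t s a (y t s a)"
    and "a \<in> {1..A} \<Longrightarrow> y t s a * (u t s a + future v t s a - v t s) = 0"
proof -
  have yz: "feasible y z" using opt unfolding primal_optimal_iff by (rule conjunct1)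
  have df: "dual_feasible T S A p P \<phi> \<psi> u v w l" using dual unfolding dual_optimal_iff by (rule conjunct1)
  define Y where "Y t s a = integral {0..y t s a} (\<phi> t s a)
    + integral {\<phi> t s a 0..u t s a} (inv_into {0..\<rho>} (\<phi> t s a)) - y t s a * u t s a" for t s a
  define Z where "Z t s = integral {0..z t s} (\<psi> t s)
    + integral {\<psi> t s 0..w t s} (inv_into {0..\<rho>} (\<psi> t s)) - z t s * w t s" for t s
  define G where "G t s = (\<Sum>a\<in>{1..A}. Y t s a + y t s a * (u t s a + future v t s a - v t s))
    + (Z t s + z t s * (w t s + l t s - v t s) + (p t s - z t s) * l t s)" for t s
  have "(\<Sum>t\<in>{1..T}. \<Sum>s\<in>{1..S}. G t s)
      = primal_objective T S A \<phi> \<psi> y z - dual_objective T S A p \<phi> \<psi> u v w l"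
    using lagrangian_gap[OF yz, of u w v l]
    by (simp add: G_def Y_def Z_def primal_objective_def dual_objective_def
        sum.distrib sum_subtractf mult.commute)
  then have total: "(\<Sum>t\<in>{1..T}. \<Sum>s\<in>{1..S}. G t s) \<le> 0"
    using no_duality_gap[OF opt dual] by simp
  have Y0: "0 \<le> Y t s a" if "t \<in> {1..T}" "s \<in> {1..S}" "a \<in> {1..A}" for t s a
    using Young_inequality(1)[OF \<phi>_cont[OF that] \<phi>_mono[OF that] feasible_range(1)[OF yz that]] df that
    unfolding Y_def dual_feasible_iff by auto
  have Z0: "0 \<le> Z t s" if "t \<in> {1..T}" "s \<in> {1..S}" for t s
    using Young_inequality(1)[OF \<psi>_cont[OF that] \<psi>_mono[OF that] feasible_range(2)[OF yz that]] df that
    unfolding Z_def dual_feasible_iff by auto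
  have y0: "0 \<le> y t s a * (u t s a + future v t s a - v t s)"
    if "t \<in> {1..T}" "s \<in> {1..S}" "a \<in> {1..A}" for t s a
    using yz df that unfolding feasible_iff dual_feasible_iff by (intro mult_nonneg_nonneg) auto
  have z0: "0 \<le> z t s * (w t s + l t s - v t s)" "0 \<le> (p t s - z t s) * l t s"
    if "t \<in> {1..T}" "s \<in> {1..S}" for t s
    using yz df that unfolding feasible_iff dual_feasible_iff by (auto intro!: mult_nonneg_nonneg)
  have Ya0: "0 \<le> (\<Sum>a\<in>{1..A}. Y t s a + y t s a * (u t s a + future v t s a - v t s))"
    if "t \<in> {1..T}" "s \<in> {1..S}" for t s
    using Y0 y0 that by (intro sum_nonneg add_nonneg_nonneg)
  have G0: "0 \<le> G t s" if "t \<in> {1..T}" "s \<in> {1..S}" for t s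
    unfolding G_def using that Ya0 Z0 z0 by (intro add_nonneg_nonneg) auto
  have "G t s \<le> (\<Sum>s\<in>{1..S}. G t s)"
    using G0 ts by (intro member_le_sum) auto
  also have "\<dots> \<le> (\<Sum>t\<in>{1..T}. \<Sum>s\<in>{1..S}. G t s)"
    using G0 ts by (intro member_le_sum[where f = "\<lambda>t. \<Sum>s\<in>{1..S}. G t s"] sum_nonneg) auto
  finally have "G t s \<le> 0" using total by simp
  then have Ya: "(\<Sum>a\<in>{1..A}. Y t s a + y t s a * (u t s a + future v t s a - v t s)) = 0"
    and Z: "Z t s = 0" and zl: "z t s * (w t s + l t s - v t s) = 0" "(p t s - z t s) * l t s = 0"
    using Ya0[OF ts] Z0[OF ts] z0[OF ts] unfolding G_def by linarith+
  show "z t s * (w t s + l t s - v t s) = 0" "(p t s - z t s) * l t s = 0" by (fact zl)+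
  show "w t s = \<psi> t s (z t s)"
    using Young_inequality(2)[OF \<psi>_cont[OF ts] \<psi>_mono[OF ts] feasible_range(2)[OF yz ts]] df ts Z
    unfolding Z_def dual_feasible_iff by auto
  assume a: "a \<in> {1..A}"
  have "Y t s a + y t s a * (u t s a + future v t s a - v t s) = 0"
    using Y0 y0 ts a by (intro sum_nonneg_0[OF _ _ Ya]) auto
  then have Y: "Y t s a = 0" and "y t s a * (u t s a + future v t s a - v t s) = 0"
    using Y0[OF ts a] y0[OF ts a] by linarith+
  then show "y t s a * (u t s a + future v t s a - v t s) = 0" by simp
  show "u t s a = \<phi> t s a (y t s a)"
    using Young_inequality(2)[OF \<phi>_cont[OF ts a] \<phi>_mono[OF ts a] feasible_range(1)[OF yz ts a]] df ts a Y
    unfolding Y_def dual_feasible_iff by auto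
qed

lemma optimal_action:
  assumes opt: "primal_optimal T S A p P \<phi> \<psi> y z"
    and dual: "dual_optimal T S A p P \<phi> \<psi> u v w l"
    and tsa: "t \<in> {1..T}" "s \<in> {1..S}" "a \<in> {1..A}" and pos: "0 < y t s a"
  shows "v t s = Min ((\<lambda>a'. \<phi> t s a' (y t s a') + future v t s a') ` {1..A})"
    and "\<phi> t s a (y t s a) + future v t s a
      = Min ((\<lambda>a'. \<phi> t s a' (y t s a') + future v t s a') ` {1..A})"
proof -
  note cs = complementary_slackness[OF opt dual tsa(1,2)]
  have df: "dual_feasible T S A p P \<phi> \<psi> u v w l"
    using dual unfolding dual_optimal_iff by (rule conjunct1)
  have attained: "\<phi> t s a (y t s a) + future v t s a = v t s"
    using cs(4,5)[OF tsa(3)] pos by simp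
  have "v t s \<le> u t s a' + future v t s a'" if "a' \<in> {1..A}" for a'
    using df tsa(1,2) that unfolding dual_feasible_iff by blast
  then have "v t s \<le> \<phi> t s a' (y t s a') + future v t s a'" if "a' \<in> {1..A}" for a'
    unfolding cs(4)[OF that, symmetric] using that by blast
  then have "Min ((\<lambda>a'. \<phi> t s a' (y t s a') + future v t s a') ` {1..A}) = v t s"
    using attained tsa(3) by (intro Min_eqI image_eqI[where x = a]) auto
  with attained show "v t s = Min ((\<lambda>a'. \<phi> t s a' (y t s a') + future v t s a') ` {1..A})"
    and "\<phi> t s a (y t s a) + future v t s a
      = Min ((\<lambda>a'. \<phi> t s a' (y t s a') + future v t s a') ` {1..A})" by simp_all
qed

text \<open>
  If \<open>z < p\<close> the multiplier \<open>l\<close> vanishes, and if \<open>z > 0\<close> the constraint \<open>v \<le> w + l\<close> is tight.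
  The bounds in the two extreme cases follow from \<open>w = \<psi>(z)\<close> and monotonicity of \<open>\<psi>\<close>.
\<close>
lemma optimal_price:
  assumes opt: "primal_optimal T S A p P \<phi> \<psi> y z"
    and dual: "dual_optimal T S A p P \<phi> \<psi> u v w l"
    and ts: "t \<in> {1..T}" "s \<in> {1..S}" and pos: "0 < p t s"
  shows "z t s = 0 \<Longrightarrow> v t s \<le> \<psi> t s (p t s)"
    and "\<lbrakk>0 < z t s; z t s < p t s\<rbrakk> \<Longrightarrow> v t s = \<psi> t s (z t s)"
    and "z t s = p t s \<Longrightarrow> v t s \<ge> \<psi> t s 0"
proof -
  note cs = complementary_slackness(1-3)[OF opt dual ts]
  have vl: "v t s \<le> w t s + l t s" "0 \<le> l t s"
    using dual ts unfolding dual_optimal_iff dual_feasible_iff by auto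
  have "p t s \<in> {0..\<rho>}"
    using opt ts unfolding primal_optimal_iff by (blast intro: feasible_range(3))
  then have le: "\<psi> t s 0 \<le> \<psi> t s (p t s)"
    using pos by (intro mono_onD[OF strict_mono_on_imp_mono_on[OF \<psi>_mono[OF ts]]]) auto
  show "v t s \<le> \<psi> t s (p t s)" if "z t s = 0"
    using cs vl le pos that by simp
  show "v t s = \<psi> t s (z t s)" if "0 < z t s" "z t s < p t s"
    using cs that by simp
  show "v t s \<ge> \<psi> t s 0" if "z t s = p t s"
    using cs vl le pos that by simp
qed

end

theorem theorem1:
  fixes T S A :: nat
    and p :: "nat \<Rightarrow> nat \<Rightarrow> real"
    and P :: "nat \<Rightarrow> nat \<Rightarrow> nat \<Rightarrow> real"
    and \<phi> :: "nat \<Rightarrow> nat \<Rightarrow> nat \<Rightarrow> real \<Rightarrow> real"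
    and \<psi> :: "nat \<Rightarrow> nat \<Rightarrow> real \<Rightarrow> real"
    and y u :: "nat \<Rightarrow> nat \<Rightarrow> nat \<Rightarrow> real"
    and z v w l :: "nat \<Rightarrow> nat \<Rightarrow> real"
  assumes T_pos: "0 < T" and S_pos: "0 < S" and A_pos: "0 < A"
    and p_nonneg: "\<forall>t\<in>{1..T}. \<forall>s\<in>{1..S}. 0 \<le> p t s"
    and P_range: "\<forall>s\<in>{1..S}. \<forall>a\<in>{1..A}. \<forall>s'\<in>{1..S}. P s a s' \<in> {0..1}"
    and P_sum: "\<forall>s\<in>{1..S}. \<forall>a\<in>{1..A}. (\<Sum>s'\<in>{1..S}. P s a s') = 1"
    and \<phi>_cont: "\<forall>t\<in>{1..T}. \<forall>s\<in>{1..S}. \<forall>a\<in>{1..A}.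
      continuous_on {0..total_mass T S p} (\<phi> t s a)"
    and \<phi>_mono: "\<forall>t\<in>{1..T}. \<forall>s\<in>{1..S}. \<forall>a\<in>{1..A}.
      strict_mono_on {0..total_mass T S p} (\<phi> t s a)"
    and \<psi>_cont: "\<forall>t\<in>{1..T}. \<forall>s\<in>{1..S}. continuous_on {0..total_mass T S p} (\<psi> t s)"
    and \<psi>_mono: "\<forall>t\<in>{1..T}. \<forall>s\<in>{1..S}. strict_mono_on {0..total_mass T S p} (\<psi> t s)"
    and primal: "primal_optimal T S A p P \<phi> \<psi> y z"
    and dual: "dual_optimal T S A p P \<phi> \<psi> u v w l"
  shows
    "(\<forall>t\<in>{1..T}. \<forall>s\<in>{1..S}. 0 < p t s \<longrightarrow>
        (z t s = 0 \<longrightarrow> v t s \<le> \<psi> t s (p t s)) \<and>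
        (0 < z t s \<and> z t s < p t s \<longrightarrow> v t s = \<psi> t s (z t s)) \<and>
        (z t s = p t s \<longrightarrow> v t s \<ge> \<psi> t s 0)) \<and>
     (\<forall>s\<in>{1..S}. \<forall>a\<in>{1..A}.
        (0 < y T s a \<longrightarrow>
           v T s = Min ((\<lambda>a'. \<phi> T s a' (y T s a')) ` {1..A}) \<and>
           \<phi> T s a (y T s a) = Min ((\<lambda>a'. \<phi> T s a' (y T s a')) ` {1..A})) \<and>
        (\<forall>t\<in>{1..<T}. 0 < y t s a \<longrightarrow>
           v t s = Min ((\<lambda>a'. \<phi> t s a' (y t s a') + (\<Sum>s'\<in>{1..S}. P s a' s' * v (t + 1) s')) ` {1..A}) \<and>
           \<phi> t s a (y t s a) + (\<Sum>s'\<in>{1..S}. P s a s' * v (t + 1) s')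
             = Min ((\<lambda>a'. \<phi> t s a' (y t s a') + (\<Sum>s'\<in>{1..S}. P s a' s' * v (t + 1) s')) ` {1..A})))"
proof -
  interpret congestion_network T S A p P \<phi> \<psi>
    by unfold_locales
      (use T_pos A_pos p_nonneg P_range P_sum \<phi>_cont \<phi>_mono \<psi>_cont \<psi>_mono in auto)
  note price = optimal_price[OF primal dual] and action = optimal_action[OF primal dual]
  have T: "T \<in> {1..T}" using T_pos by simp
  have last: "future v T s a = 0" for s a by (simp add: future_def)
  have next_step: "future v t s a = (\<Sum>s'\<in>{1..S}. P s a s' * v (t + 1) s')" if "t \<in> {1..<T}" for t s a
    using that by (simp add: future_def)
  show ?thesis
  proof (intro conjI ballI impI)
    fix s a assume sa: "s \<in> {1..S}" "a \<in> {1..A}"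
    show "v T s = Min ((\<lambda>a'. \<phi> T s a' (y T s a')) ` {1..A})"
      "\<phi> T s a (y T s a) = Min ((\<lambda>a'. \<phi> T s a' (y T s a')) ` {1..A})" if "0 < y T s a"
      using action[OF T sa that] unfolding last by simp_all
    fix t assume t: "t \<in> {1..<T}" and pos: "0 < y t s a"
    then have "t \<in> {1..T}" by simp
    from action[OF this sa pos]
    show "v t s = Min ((\<lambda>a'. \<phi> t s a' (y t s a') + (\<Sum>s'\<in>{1..S}. P s a' s' * v (t + 1) s')) ` {1..A})"
      "\<phi> t s a (y t s a) + (\<Sum>s'\<in>{1..S}. P s a s' * v (t + 1) s')
         = Min ((\<lambda>a'. \<phi> t s a' (y t s a') + (\<Sum>s'\<in>{1..S}. P s a' s' * v (t + 1) s')) ` {1..A})"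
      unfolding next_step[OF t] .
  qed (use price in blast)+
qed

end
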